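(* Let $d\ge 1$, let $A\subseteq[0,\infty)$ have at least two elements, and fix a nonzero vector $x\in\mathbb{R}^d$. Then there is a residual set $R\subseteq\Omega$ such that for every configuration $\omega\in R$ and for any $\lambda$ with $$\inf A\le\lambda\le\sup A$$ (where $\lambda=\infty$ is included if $\sup A=\infty$) there exists a sequence $(\mu_k)_{k=1}^\infty$ of positive real numbers with $\mu_k\to\infty$ such that $$\lim_{k\to\infty}\frac{T(0,\mu_k x)}{\mu_k|x|}=\lambda .$$
   Context: Let $E$ be the set of nearest neighbor edges of the lattice $\mathbb{Z}^d$ (edges join lattice points at $\ell_1$-distance $1$). The space of configurations is $\Omega=\prod_{e\in E}A$, where $A$ carries the subspace topology inherited from $\mathbb{R}$ and $\Omega$ the product topology. A subset of $\Omega$ is residual if its complement is meager, i.e. a countable union of nowhere dense sets. For a configuration $\omega=(\tau(e))_{e\in E}\in\Omega$, $\tau(e)$ is the passage time of the edge $e$; for a finite path $\Gamma$ of consecutive edges, $\tau(\Gamma)=\sum_{e\in\Gamma}\tau(e)$. For $x,y\in\mathbb{R}^d$, $T(x,y)=\inf_\Gamma\tau(\Gamma)$, the infimum being over all finite paths $\Gamma$ connecting $x'$ to $y'$, where $x',y'\in\mathbb{Z}^d$ are the unique lattice points with $x\in x'+[0,1)^d$ and $y\in y'+[0,1)^d$. For $x\in\mathbb{R}^d$, $|x|$ denotes the $\ell_1$ norm of $x$. *)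

theory Defs
  imports "HOL-Analysis.Analysis"
begin

section \<open>Meager and residual sets\<close>

definition nowhere_dense_in :: "'a topology \<Rightarrow> 'a set \<Rightarrow> bool" where
  "nowhere_dense_in X S \<longleftrightarrow> S \<subseteq> topspace X \<and> X interior_of (X closure_of S) = {}"

definition meager_in :: "'a topology \<Rightarrow> 'a set \<Rightarrow> bool" where
  "meager_in X S \<longleftrightarrow> (\<exists>\<N>. countable \<N> \<and> (\<forall>N\<in>\<N>. nowhere_dense_in X N) \<and> S = \<Union>\<N>)"

definition residual_in :: "'a topology \<Rightarrow> 'a set \<Rightarrow> bool" where
  "residual_in X S \<longleftrightarrow> S \<subseteq> topspace X \<and> meager_in X (topspace X - S)"

section \<open>The lattice and the space of configurations\<close>

text \<open>The dimension \<open>d \<ge> 1\<close> is the cardinality of the finite index type \<open>'d\<close>.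
  The \<open>\<ell>\<^sub>1\<close> norm is used both on \<open>int ^ 'd\<close> and on \<open>real ^ 'd\<close>.\<close>

definition l1_norm :: "('a::{abs,comm_monoid_add}) ^ 'd \<Rightarrow> 'a" where
  "l1_norm x = (\<Sum>i\<in>UNIV. \<bar>x $ i\<bar>)"

definition adjacent :: "int ^ 'd \<Rightarrow> int ^ 'd \<Rightarrow> bool" where
  "adjacent u v \<longleftrightarrow> l1_norm (u - v) = 1"

definition lattice_edges :: "(int ^ 'd) set set" where
  "lattice_edges = {{u, v} | u v. adjacent u v}"

text \<open>The points of this space are the functions on edges with values in \<open>A\<close>, extended by
  \<open>undefined\<close> to sets of lattice points that are not edges.\<close>

definition config_space :: "real set \<Rightarrow> ((int ^ 'd) set \<Rightarrow> real) topology" where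
  "config_space A = product_topology (\<lambda>e. top_of_set A) lattice_edges"

section \<open>Passage times\<close>

text \<open>A finite path is given by the nonempty list of the lattice points it visits; the list
  \<open>[u]\<close> is the path without edges from \<open>u\<close> to \<open>u\<close>.\<close>

definition path_between :: "int ^ 'd \<Rightarrow> int ^ 'd \<Rightarrow> (int ^ 'd) list \<Rightarrow> bool" where
  "path_between u v p \<longleftrightarrow> p \<noteq> [] \<and> hd p = u \<and> last p = v \<and> successively adjacent p"

definition path_time :: "((int ^ 'd) set \<Rightarrow> real) \<Rightarrow> (int ^ 'd) list \<Rightarrow> real" where
  "path_time \<omega> p = (\<Sum>(u, v) \<leftarrow> zip p (tl p). \<omega> {u, v})"

definition lattice_point :: "real ^ 'd \<Rightarrow> int ^ 'd" where
  "lattice_point x = (\<chi> i. \<lfloor>x $ i\<rfloor>)"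

lemma lattice_point_eq_iff:
  "lattice_point x = z \<longleftrightarrow> (\<forall>i. x $ i - real_of_int (z $ i) \<in> {0..<1})"
  by (auto simp: lattice_point_def vec_eq_iff floor_eq_iff algebra_simps)

text \<open>The infimum of a nonempty set of nonnegative reals whenever \<open>\<omega>\<close> is a configuration
  with nonnegative values, because the lattice is connected.\<close>

definition passage_time ::
    "((int ^ 'd) set \<Rightarrow> real) \<Rightarrow> real ^ 'd \<Rightarrow> real ^ 'd \<Rightarrow> real" where
  "passage_time \<omega> x y =
     (INF p \<in> {p. path_between (lattice_point x) (lattice_point y) p}. path_time \<omega> p)"

end

theory Submission
  imports Defs
begin

text \<open>
  The level of an edge is the smaller \<open>\<ell>\<^sub>1\<close> norm of its endpoints. A path from the origin to
  \<open>y\<close> crosses every level below \<open>|y|\<close>, and a monotone path crosses each of them exactly once.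
  Hence a configuration whose value at an edge depends only on the level \<open>k\<close> of that edge, say
  \<open>c k\<close>, has passage time \<open>\<Sum>k<|y|. c k\<close> from \<open>0\<close> to \<open>y\<close>. If the averages of \<open>c\<close> tend to \<open>q\<close>, then
  changing finitely many levels, or perturbing finitely many of the remaining values slightly,
  still leaves \<open>T(0, \<mu>x) / (\<mu>|x|)\<close> close to \<open>q\<close> for some large \<open>\<mu>\<close>. So for every \<open>q\<close>
  strictly between \<open>inf A\<close> and \<open>sup A\<close> a generic configuration has \<open>q\<close> as a cluster value of the
  quotient, and it suffices to treat the rational \<open>q\<close>, since cluster values form a closed set.
\<close>

section \<open>Residual sets\<close>

text \<open>An open \<open>V\<close> inside \<open>S\<close> misses the complement of
  \<open>S\<close>, hence also the closure of that complement. Asking for an open piece of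
  \<open>U \<inter> S\<close>, rather than for \<open>S\<close> to be open and dense, avoids any
  continuity argument for the passage time.\<close>

lemma nowhere_dense_in_compl:
  assumes "\<And>U. openin X U \<Longrightarrow> U \<noteq> {} \<Longrightarrow> \<exists>V. openin X V \<and> V \<noteq> {} \<and> V \<subseteq> U \<inter> S"
  shows "nowhere_dense_in X (topspace X - S)"
  unfolding nowhere_dense_in_def
proof (intro conjI)
  let ?U = "X interior_of (X closure_of (topspace X - S))"
  show "?U = {}"
  proof (rule ccontr)
    assume "?U \<noteq> {}"
    then obtain V where V: "openin X V" "V \<noteq> {}" "V \<subseteq> ?U \<inter> S"
      using assms[of ?U] by auto
    then have "V \<inter> X closure_of (topspace X - S) = {}"
      by (auto simp: openin_Int_closure_of_eq_empty)
    with V show False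
      using interior_of_subset[of X "X closure_of (topspace X - S)"] by blast
  qed
qed auto

lemma residual_in_INT:
  assumes "countable I" and "\<And>i. i \<in> I \<Longrightarrow> nowhere_dense_in X (topspace X - S i)"
  shows "residual_in X (topspace X \<inter> (\<Inter>i\<in>I. S i))"
  unfolding residual_in_def meager_in_def
  by (intro conjI exI[of _ "(\<lambda>i. topspace X - S i) ` I"]) (use assms in auto)

section \<open>Norms on the lattice\<close>

definition lattice_norm :: "int ^ 'd \<Rightarrow> nat" where
  "lattice_norm u = nat (l1_norm u)"

lemma l1_norm_nonneg: "l1_norm (u :: int ^ 'd) \<ge> 0"
  by (simp add: l1_norm_def sum_nonneg)

lemma int_lattice_norm: "int (lattice_norm u) = l1_norm u"
  by (simp add: lattice_norm_def l1_norm_nonneg)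

lemma lattice_norm_0 [simp]: "lattice_norm 0 = 0"
  by (simp add: lattice_norm_def l1_norm_def)

lemma lattice_norm_eq_0_iff: "lattice_norm u = 0 \<longleftrightarrow> u = 0"
proof -
  have "lattice_norm u = 0 \<longleftrightarrow> l1_norm u = 0"
    using l1_norm_nonneg[of u] by (auto simp: lattice_norm_def)
  also have "\<dots> \<longleftrightarrow> u = 0"
    by (simp add: l1_norm_def sum_nonneg_eq_0_iff vec_eq_iff)
  finally show ?thesis .
qed

lemma adjacent_commute: "adjacent u v \<longleftrightarrow> adjacent v u"
  by (simp add: adjacent_def l1_norm_def abs_minus_commute)

lemma adjacent_lattice_norm_le:
  assumes "adjacent u v"
  shows "lattice_norm v \<le> Suc (lattice_norm u)"
proof -
  have "l1_norm v \<le> l1_norm u + l1_norm (u - v)"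
    unfolding l1_norm_def sum.distrib[symmetric] by (rule sum_mono) auto
  with assms show ?thesis
    by (simp add: adjacent_def lattice_norm_def)
qed

text \<open>Move one nonzero coordinate of \<open>y\<close> by one unit towards zero.\<close>

lemma exists_adjacent_lower:
  assumes "lattice_norm y = Suc m"
  shows "\<exists>z. adjacent z y \<and> lattice_norm z = m"
proof -
  from assms have "y \<noteq> 0" by auto
  then obtain i where i: "y $ i \<noteq> 0"
    by (auto simp: vec_eq_iff)
  define z where "z = (\<chi> j. if j = i then y $ i - sgn (y $ i) else y $ j)"
  have "\<bar>y $ j\<bar> = \<bar>z $ j\<bar> + (if j = i then 1 else 0)" for j
    using i by (auto simp: z_def sgn_if)
  then have "l1_norm y = l1_norm z + 1"
    by (simp add: l1_norm_def sum.distrib)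
  moreover have "\<bar>(z - y) $ j\<bar> = (if j = i then 1 else 0)" for j
    using i by (auto simp: z_def sgn_if)
  then have "adjacent z y"
    by (simp add: adjacent_def l1_norm_def)
  ultimately show ?thesis
    using assms l1_norm_nonneg[of z] by (intro exI[of _ z]) (auto simp: lattice_norm_def)
qed

lemma finite_lattice_norm_le: "finite {u :: int ^ 'd. lattice_norm u \<le> m}"
proof (rule finite_subset)
  show "finite (vec_lambda ` (UNIV \<rightarrow>\<^sub>E {- int m..int m}) :: (int ^ 'd) set)"
    by (intro finite_imageI finite_PiE) auto
  show "{u :: int ^ 'd. lattice_norm u \<le> m} \<subseteq> vec_lambda ` (UNIV \<rightarrow>\<^sub>E {- int m..int m})"
  proof
    fix u :: "int ^ 'd" assume "u \<in> {u. lattice_norm u \<le> m}"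
    then have "l1_norm u \<le> int m"
      by (simp add: int_lattice_norm[symmetric])
    moreover have "\<bar>u $ i\<bar> \<le> l1_norm u" for i
      unfolding l1_norm_def by (rule member_le_sum) auto
    ultimately have "\<bar>u $ i\<bar> \<le> int m" for i
      by (rule order_trans[rotated])
    then have "vec_nth u \<in> UNIV \<rightarrow>\<^sub>E {- int m..int m}"
      by (auto simp: abs_le_iff minus_le_iff)
    then show "u \<in> vec_lambda ` (UNIV \<rightarrow>\<^sub>E {- int m..int m})"
      by (intro image_eqI[of _ _ "vec_nth u"]) auto
  qed
qed

text \<open>Taking the floor changes the absolute value of each coordinate by at most 1. The bound
  does not depend on \<open>y\<close>, so it disappears after division by a large
  \<open>\<mu>\<close>.\<close>

lemma lattice_norm_lattice_point:
  fixes y :: "real ^ 'd"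
  shows "\<bar>real (lattice_norm (lattice_point y)) - l1_norm y\<bar> \<le> CARD('d)"
proof -
  have "real (lattice_norm (lattice_point y)) = (\<Sum>i\<in>UNIV. \<bar>of_int \<lfloor>y $ i\<rfloor>\<bar>)"
    using arg_cong[OF int_lattice_norm[of "lattice_point y"], of real_of_int]
    by (simp add: l1_norm_def lattice_point_def)
  then have "\<bar>real (lattice_norm (lattice_point y)) - l1_norm y\<bar>
      = \<bar>\<Sum>i\<in>UNIV. \<bar>of_int \<lfloor>y $ i\<rfloor>\<bar> - \<bar>y $ i\<bar>\<bar>"
    by (simp add: l1_norm_def sum_subtractf)
  also have "\<dots> \<le> (\<Sum>i\<in>(UNIV :: 'd set). 1)"
  proof (rule order_trans[OF sum_abs sum_mono])
    fix i show "\<bar>\<bar>of_int \<lfloor>y $ i\<rfloor>\<bar> - \<bar>y $ i\<bar>\<bar> \<le> 1" by linarith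
  qed
  finally show ?thesis by simp
qed

section \<open>Levels of edges and bounds for passage times\<close>

definition edge_level :: "(int ^ 'd) set \<Rightarrow> nat" where
  "edge_level e = Min (lattice_norm ` e)"

lemma edge_level_pair: "edge_level {u, v} = min (lattice_norm u) (lattice_norm v)"
  by (simp add: edge_level_def)

text \<open>Both endpoints of such an edge lie in the finite ball of radius \<open>m\<close>.
  Constraints on the levels below \<open>m\<close> thus involve finitely many coordinates, as basic
  open sets of the product topology require.\<close>

lemma finite_edge_level_less: "finite {e \<in> lattice_edges :: (int ^ 'd) set set. edge_level e < m}"
proof (rule finite_subset)
  show "finite (Pow {u :: int ^ 'd. lattice_norm u \<le> m})"
    by (simp add: finite_lattice_norm_le)
  show "{e \<in> lattice_edges. edge_level e < m} \<subseteq> Pow {u :: int ^ 'd. lattice_norm u \<le> m}"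
  proof
    fix e :: "(int ^ 'd) set" assume "e \<in> {e \<in> lattice_edges. edge_level e < m}"
    then obtain u v where "e = {u, v}" "adjacent u v" "min (lattice_norm u) (lattice_norm v) < m"
      by (auto simp: lattice_edges_def edge_level_pair)
    then show "e \<in> Pow {u. lattice_norm u \<le> m}"
      using adjacent_lattice_norm_le[of u v] adjacent_lattice_norm_le[of v u]
      by (auto simp: adjacent_commute)
  qed
qed

lemma path_time_Cons_Cons: "path_time \<omega> (u # v # p) = \<omega> {u, v} + path_time \<omega> (v # p)"
  by (simp add: path_time_def)

lemma path_time_snoc:
  "p \<noteq> [] \<Longrightarrow> path_time \<omega> (p @ [y]) = path_time \<omega> p + \<omega> {last p, y}"
  by (induction p rule: induct_list012) (simp_all add: path_time_def)

text \<open>The partial sums of \<open>g\<close>, evaluated at the lattice norm, act as a potential: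
  no edge raises the potential by more than its passage time, and the increments telescope along the
  path.\<close>

lemma path_time_ge:
  assumes "\<And>e. e \<in> lattice_edges \<Longrightarrow> g (edge_level e) \<le> \<omega> e" and g: "\<And>k. 0 \<le> g k"
    and "p \<noteq> []" and "successively adjacent p"
  shows "(\<Sum>k<lattice_norm (last p). g k) - (\<Sum>k<lattice_norm (hd p). g k) \<le> path_time \<omega> p"
  using assms(3,4)
proof (induction p rule: induct_list012)
  case (3 u v p)
  define G where "G m = (\<Sum>k<m. g k)" for m
  have adj: "adjacent u v" using 3 by simp
  then have e: "{u, v} \<in> lattice_edges"
    by (auto simp: lattice_edges_def)
  have "G (lattice_norm v) - G (lattice_norm u) \<le> \<omega> {u, v}"
  proof (cases "lattice_norm v \<le> lattice_norm u")
    case True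
    then have "G (lattice_norm v) \<le> G (lattice_norm u)"
      unfolding G_def using g by (intro sum_mono2) auto
    moreover have "0 \<le> \<omega> {u, v}"
      using assms(1)[OF e] g by (meson order_trans)
    ultimately show ?thesis by linarith
  next
    case False
    then have "lattice_norm v = Suc (lattice_norm u)"
      using adjacent_lattice_norm_le[OF adj] by simp
    then show ?thesis
      using assms(1)[OF e] by (simp add: edge_level_pair G_def)
  qed
  moreover have "G (lattice_norm (last (v # p))) - G (lattice_norm v) \<le> path_time \<omega> (v # p)"
    using 3 by (simp add: G_def)
  ultimately show ?case
    by (simp add: path_time_Cons_Cons G_def)
qed (simp_all add: path_time_def)

text \<open>Descend from \<open>y\<close> to the origin by neighbours of smaller norm; each level
  below \<open>m\<close> is used exactly once.\<close>

lemma exists_path_time_le: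
  assumes "\<And>e. e \<in> lattice_edges \<Longrightarrow> edge_level e < m \<Longrightarrow> \<omega> e \<le> h (edge_level e)"
    and "lattice_norm y = m"
  shows "\<exists>p. path_between 0 y p \<and> path_time \<omega> p \<le> (\<Sum>k<m. h k)"
  using assms
proof (induction m arbitrary: y)
  case 0
  then have "y = 0" by (simp add: lattice_norm_eq_0_iff)
  then show ?case
    by (intro exI[of _ "[0]"]) (simp add: path_between_def path_time_def)
next
  case (Suc m)
  obtain z where z: "adjacent z y" "lattice_norm z = m"
    using exists_adjacent_lower[OF Suc.prems(2)] by blast
  obtain p where p: "path_between 0 z p" "path_time \<omega> p \<le> (\<Sum>k<m. h k)"
    using Suc.IH[of z] Suc.prems(1) z(2) by (meson less_Suc_eq)
  have "{z, y} \<in> lattice_edges" "edge_level {z, y} = m"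
    using z Suc.prems(2) by (auto simp: lattice_edges_def edge_level_pair)
  then have "\<omega> {z, y} \<le> h m"
    using Suc.prems(1)[of "{z, y}"] by simp
  moreover have "path_between 0 y (p @ [y])"
    using p(1) z(1) by (auto simp: path_between_def successively_append_iff)
  ultimately show ?case
    using p by (intro exI[of _ "p @ [y]"]) (auto simp: path_time_snoc path_between_def)
qed

lemma lattice_point_0 [simp]: "lattice_point 0 = 0"
  by (simp add: lattice_point_def vec_eq_iff)

text \<open>The bound by \<open>g\<close> must hold on every edge, since a competing path may wander
  arbitrarily far; the bound by \<open>h\<close> concerns only a monotone path, which stays below
  level \<open>m\<close>. The lower bound also makes the infimum well behaved.\<close>

lemma passage_time_bounds:
  fixes y :: "real ^ 'd"
  defines "m \<equiv> lattice_norm (lattice_point y)"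
  assumes g: "\<And>e. e \<in> lattice_edges \<Longrightarrow> g (edge_level e) \<le> \<omega> e" "\<And>k. 0 \<le> g k"
    and h: "\<And>e. e \<in> lattice_edges \<Longrightarrow> edge_level e < m \<Longrightarrow> \<omega> e \<le> h (edge_level e)"
  shows "(\<Sum>k<m. g k) \<le> passage_time \<omega> 0 y" and "passage_time \<omega> 0 y \<le> (\<Sum>k<m. h k)"
proof -
  let ?P = "{p. path_between 0 (lattice_point y) p}"
  have lower: "(\<Sum>k<m. g k) \<le> path_time \<omega> p" if "p \<in> ?P" for p
    using path_time_ge[of g \<omega> p] g that by (auto simp: path_between_def m_def)
  have "\<exists>p. path_between 0 (lattice_point y) p \<and> path_time \<omega> p \<le> (\<Sum>k<m. h k)"
    by (rule exists_path_time_le[where \<omega> = \<omega> and h = h]) (use h in \<open>simp_all only: m_def\<close>)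
  then obtain p where p: "p \<in> ?P" "path_time \<omega> p \<le> (\<Sum>k<m. h k)"
    by blast
  show "(\<Sum>k<m. g k) \<le> passage_time \<omega> 0 y"
    unfolding passage_time_def lattice_point_0 using p(1) lower by (intro cINF_greatest) auto
  have "bdd_below (path_time \<omega> ` ?P)"
    using lower by (intro bdd_belowI2[of _ "\<Sum>k<m. g k"])
  then have "passage_time \<omega> 0 y \<le> path_time \<omega> p"
    unfolding passage_time_def lattice_point_0 using p(1) by (intro cINF_lower)
  with p(2) show "passage_time \<omega> 0 y \<le> (\<Sum>k<m. h k)" by linarith
qed

section \<open>Generic configurations\<close>

text \<open>With \<open>\<theta> = (q - a) / (b - a)\<close>, the value \<open>b\<close> is taken at the jumps of \<open>k \<mapsto> \<lfloor>k \<theta>\<rfloor>\<close>.\<close>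

lemma exists_seq_with_average:
  fixes a b q :: real
  assumes "a < q" and "q < b"
  shows "\<exists>c :: nat \<Rightarrow> real. range c \<subseteq> {a, b} \<and> (\<forall>m. \<bar>(\<Sum>k<m. c k) - q * real m\<bar> \<le> b - a)"
proof -
  define \<theta> where "\<theta> = (q - a) / (b - a)"
  have \<theta>: "0 \<le> \<theta>" "\<theta> < 1" "(b - a) * \<theta> = q - a"
    using assms by (simp_all add: \<theta>_def)
  define c where "c k = a + (b - a) * of_int (\<lfloor>real (Suc k) * \<theta>\<rfloor> - \<lfloor>real k * \<theta>\<rfloor>)" for k
  have "c k \<in> {a, b}" for k
  proof -
    have "real (Suc k) * \<theta> = real k * \<theta> + \<theta>" by (simp add: algebra_simps)
    then have "\<lfloor>real (Suc k) * \<theta>\<rfloor> - \<lfloor>real k * \<theta>\<rfloor> \<in> {0, 1}"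
      using \<theta>(1,2) by simp linarith
    then consider "\<lfloor>real (Suc k) * \<theta>\<rfloor> - \<lfloor>real k * \<theta>\<rfloor> = 0"
      | "\<lfloor>real (Suc k) * \<theta>\<rfloor> - \<lfloor>real k * \<theta>\<rfloor> = 1"
      by blast
    then show ?thesis
      by cases (simp_all only: c_def, simp_all)
  qed
  moreover have "\<bar>(\<Sum>k<m. c k) - q * real m\<bar> \<le> b - a" for m
  proof -
    have q: "q * real m = (a + (b - a) * \<theta>) * real m"
      unfolding \<theta>(3) by simp
    \<comment> \<open>The increments of the floors telescope, so rounding costs at most one jump
      \<open>b - a\<close>.\<close>
    have "(\<Sum>k<m. c k) = a * real m + (b - a) * of_int \<lfloor>real m * \<theta>\<rfloor>"
      by (induction m) (simp_all add: c_def algebra_simps)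
    also have "\<dots> - q * real m = (b - a) * (of_int \<lfloor>real m * \<theta>\<rfloor> - real m * \<theta>)"
      by (subst q) (simp add: algebra_simps)
    finally have "\<bar>(\<Sum>k<m. c k) - q * real m\<bar> = (b - a) * \<bar>of_int \<lfloor>real m * \<theta>\<rfloor> - real m * \<theta>\<bar>"
      using assms by (simp add: abs_mult)
    also have "\<dots> \<le> (b - a) * 1"
      using assms by (intro mult_left_mono) linarith+
    finally show ?thesis by simp
  qed
  ultimately show ?thesis by (intro exI[of _ c]) auto
qed

section \<open>Density of the configurations with a ratio close to a prescribed value\<close>

lemma sum_if_less_le:
  fixes B :: real
  assumes "0 \<le> B"
  shows "(\<Sum>k<m. if k < N then B else 0) \<le> real N * B"
proof -
  have "(\<Sum>k<m. if k < N then B else 0) = (\<Sum>k\<in>{..<m} \<inter> {..<N}. B)"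
    by (subst sum.If_cases) (simp_all add: lessThan_def)
  also have "\<dots> \<le> (\<Sum>k<N. B)"
    using assms by (intro sum_mono2) auto
  finally show ?thesis by simp
qed

lemma topspace_config_space [simp]:
  "topspace (config_space A) = lattice_edges \<rightarrow>\<^sub>E A"
  by (simp add: config_space_def)

text \<open>One index \<open>n\<close> controls both the size of \<open>\<mu>\<close> and the
  tolerance, so membership for all \<open>n\<close> makes \<open>q\<close> a cluster value as
  \<open>\<mu>\<close> tends to infinity.\<close>

definition near_value_configs :: "real ^ 'd \<Rightarrow> real \<Rightarrow> nat \<Rightarrow> ((int ^ 'd) set \<Rightarrow> real) set" where
  "near_value_configs x q n =
     {\<omega>. \<exists>\<mu> > real n. \<bar>passage_time \<omega> 0 (\<mu> *\<^sub>R x) / (\<mu> * l1_norm x) - q\<bar> < 1 / real (Suc n)}"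

text \<open>A basic open subset of \<open>U\<close> constrains only edges of level below some
  \<open>N\<close>. Beyond \<open>N\<close> the values may follow a sequence with average
  \<open>q\<close>, and for large \<open>\<mu>\<close> the first \<open>N\<close> levels contribute
  negligibly to the ratio.\<close>

lemma near_value_configs_dense:
  fixes A :: "real set" and x :: "real ^ 'd"
  assumes A: "A \<subseteq> {0..}" and "x \<noteq> 0" and "a \<in> A" "b \<in> A" "a < q" "q < b"
    and U: "openin (config_space A) U" "U \<noteq> {}"
  shows "\<exists>V. openin (config_space A) V \<and> V \<noteq> {} \<and> V \<subseteq> U \<inter> near_value_configs x q n"
proof -
  obtain c where c: "range c \<subseteq> {a, b}" "\<And>m. \<bar>(\<Sum>k<m. c k) - q * real m\<bar> \<le> b - a"
    using exists_seq_with_average[OF \<open>a < q\<close> \<open>q < b\<close>] by blast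
  have c_A: "c k \<in> A" and c_bounds: "0 \<le> c k" "c k \<le> b" for k
    using c(1) assms by (fastforce dest: range_subsetD[of c _ k])+
  from U obtain \<omega>\<^sub>0 where "\<omega>\<^sub>0 \<in> U" by blast
  then obtain W where W: "finite {e \<in> lattice_edges. W e \<noteq> A}"
      "\<And>e. e \<in> lattice_edges \<Longrightarrow> openin (top_of_set A) (W e)"
      "\<omega>\<^sub>0 \<in> Pi\<^sub>E lattice_edges W" "Pi\<^sub>E lattice_edges W \<subseteq> U"
    using U(1) unfolding config_space_def openin_product_topology_alt by fastforce
  obtain N where N: "\<And>e. e \<in> lattice_edges \<Longrightarrow> W e \<noteq> A \<Longrightarrow> edge_level e < N"
  proof -
    have "\<exists>N. \<forall>k \<in> edge_level ` {e \<in> lattice_edges. W e \<noteq> A}. k < N"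
      using W(1) by (intro finite_nat_set_iff_bounded[THEN iffD1] finite_imageI)
    then show ?thesis using that by blast
  qed
  \<comment> \<open>A crude common bound for \<open>\<omega>\<^sub>0\<close> on the levels below
    \<open>N\<close>: the sum of finitely many nonnegative values dominates each of them.\<close>
  define M where "M = (\<Sum>e | e \<in> lattice_edges \<and> edge_level e < N. \<omega>\<^sub>0 e)"
  have W_A: "W e \<subseteq> A" if "e \<in> lattice_edges" for e
    using openin_imp_subset[OF W(2)[OF that]] .
  have \<omega>\<^sub>0_nonneg: "0 \<le> \<omega>\<^sub>0 e" if "e \<in> lattice_edges" for e
    using PiE_mem[OF W(3) that] W_A[OF that] A by auto
  have M: "\<omega>\<^sub>0 e \<le> M" if "e \<in> lattice_edges" "edge_level e < N" for e
    unfolding M_def using that \<omega>\<^sub>0_nonneg by (intro member_le_sum finite_edge_level_less) auto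
  have "0 \<le> M"
    unfolding M_def using \<omega>\<^sub>0_nonneg by (intro sum_nonneg) auto
  have "0 < l1_norm x"
  proof -
    obtain i where "x $ i \<noteq> 0" using \<open>x \<noteq> 0\<close> by (auto simp: vec_eq_iff)
    then show ?thesis unfolding l1_norm_def by (intro sum_pos2[of _ i]) auto
  qed
  have "0 < b" "0 < q" using A \<open>a \<in> A\<close> \<open>a < q\<close> \<open>q < b\<close> by auto

  \<comment> \<open>Half of the tolerance \<open>1 / real (Suc n)\<close>: one half pays for
    perturbing the values, the other for \<open>K\<close>.\<close>
  define \<delta> where "\<delta> = 1 / (2 * real (Suc n))"
  have "0 < \<delta>" by (simp add: \<delta>_def)
  \<comment> \<open>All errors that do not grow with \<open>\<mu>\<close>: the levels below
    \<open>N\<close>, the deviation of the sums of \<open>c\<close> from \<open>q * real m\<close>,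
    and the gap between the level count \<open>m\<close> and the norm \<open>s\<close>, weighted by
    \<delta> and by \<open>q\<close>.\<close>
  define K where "K = real N * (b + M) + (b - a) + (\<delta> + q) * CARD('d)"
  have "0 \<le> K"
    using \<open>0 < b\<close> \<open>0 \<le> M\<close> \<open>a < q\<close> \<open>q < b\<close> \<open>0 < \<delta>\<close> \<open>0 < q\<close> by (simp add: K_def)
  \<comment> \<open>The first summand exceeds \<open>n\<close>; the second makes
    \<open>\<delta> * s\<close> exceed \<open>K\<close>.\<close>
  define \<mu> where "\<mu> = real (Suc n) + K / (\<delta> * l1_norm x)"
  have "real n < \<mu>"
    using \<open>0 \<le> K\<close> \<open>0 < \<delta>\<close> \<open>0 < l1_norm x\<close> by (simp add: \<mu>_def add.commute add_pos_nonneg less_add_same_cancel1)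
  then have "0 < \<mu>" by linarith
  define s where "s = \<mu> * l1_norm x"
  have "0 < s" using \<open>0 < \<mu>\<close> \<open>0 < l1_norm x\<close> by (simp add: s_def)
  have "\<delta> * s = \<delta> * real (Suc n) * l1_norm x + K"
    using \<open>0 < \<delta>\<close> \<open>0 < l1_norm x\<close> by (simp add: s_def \<mu>_def field_simps)
  then have K_less: "K < \<delta> * s"
    using \<open>0 < \<delta>\<close> \<open>0 < l1_norm x\<close> by simp
  define m where "m = lattice_norm (lattice_point (\<mu> *\<^sub>R x))"
  have "l1_norm (\<mu> *\<^sub>R x) = s"
    using \<open>0 < \<mu>\<close> by (simp add: l1_norm_def s_def abs_mult sum_distrib_left)
  then have m: "\<bar>real m - s\<bar> \<le> CARD('d)"
    using lattice_norm_lattice_point[of "\<mu> *\<^sub>R x"] by (simp add: m_def)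

  \<comment> \<open>Keeping \<open>\<omega>\<^sub>0\<close> below level \<open>N\<close> keeps the
    configuration in the given neighbourhood; all other edges are unconstrained there.\<close>
  define \<omega>\<^sub>1 where
    "\<omega>\<^sub>1 = (\<lambda>e\<in>lattice_edges. if edge_level e < N then \<omega>\<^sub>0 e else c (edge_level e))"
  \<comment> \<open>The values are pinned down only below level \<open>m\<close>, which leaves
    finitely many constraints and still controls the passage time to
    \<open>\<mu> *\<^sub>R x\<close>.\<close>
  define W' where "W' e = (if edge_level e < m then W e \<inter> ball (\<omega>\<^sub>1 e) \<delta> else W e)" for e
  define V where "V = Pi\<^sub>E lattice_edges W'"
  have "openin (config_space A) V"
    unfolding V_def config_space_def
  proof (subst openin_PiE_gen, intro disjI2 conjI ballI)
    show "finite {e \<in> lattice_edges. W' e \<noteq> topspace (top_of_set A)}"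
      by (rule finite_subset[OF _ finite_UnI[OF W(1) finite_edge_level_less[of m]]])
        (auto simp: W'_def)
    fix e :: "(int ^ 'd) set" assume e: "e \<in> lattice_edges"
    then have "openin (top_of_set A) (W e \<inter> (A \<inter> ball (\<omega>\<^sub>1 e) \<delta>))"
      by (intro openin_Int W(2) openin_open_Int open_ball)
    moreover have "W e \<inter> (A \<inter> ball (\<omega>\<^sub>1 e) \<delta>) = W e \<inter> ball (\<omega>\<^sub>1 e) \<delta>"
      using W_A[OF e] by blast
    ultimately show "openin (top_of_set A) (W' e)"
      using W(2)[OF e] by (simp add: W'_def)
  qed
  moreover have "\<omega>\<^sub>1 \<in> V"
  proof -
    have "\<omega>\<^sub>1 e \<in> W e" if "e \<in> lattice_edges" for e
      using W(3) N[OF that] c_A that by (cases "W e = A") (auto simp: \<omega>\<^sub>1_def)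
    then show ?thesis
      using \<open>0 < \<delta>\<close> by (auto simp: V_def W'_def \<omega>\<^sub>1_def)
  qed
  moreover have "V \<subseteq> U"
    unfolding V_def by (rule order_trans[OF PiE_mono W(4)]) (auto simp: W'_def)
  moreover have "\<omega> \<in> near_value_configs x q n" if "\<omega> \<in> V" for \<omega>
  proof -
    let ?T = "passage_time \<omega> 0 (\<mu> *\<^sub>R x)"
    \<comment> \<open>Zero is the only safe lower bound where the values of \<omega> are not
      compared with \<open>c\<close>, namely below \<open>N\<close> and from level \<open>m\<close>
      on; the maximum with 0 keeps \<open>g\<close> nonnegative.\<close>
    define g where "g k = (if N \<le> k \<and> k < m then max 0 (c k - \<delta>) else 0)" for k
    define h where "h k = (if k < N then M else c k) + \<delta>" for k
    have close: "\<bar>\<omega> e - \<omega>\<^sub>1 e\<bar> < \<delta>" if "e \<in> lattice_edges" "edge_level e < m" for e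
      using that \<open>\<omega> \<in> V\<close> by (auto simp: V_def W'_def dist_real_def abs_minus_commute dest!: PiE_mem)
    have nonneg: "0 \<le> \<omega> e" if "e \<in> lattice_edges" for e
      using PiE_mem[OF \<open>\<omega> \<in> V\<close>[unfolded V_def] that] W_A[OF that] A
      by (auto simp: W'_def split: if_splits)
    have g: "g (edge_level e) \<le> \<omega> e" if "e \<in> lattice_edges" for e
      using close[OF that] nonneg[OF that] that by (auto simp: g_def \<omega>\<^sub>1_def abs_less_iff)
    have h: "\<omega> e \<le> h (edge_level e)" if "e \<in> lattice_edges" "edge_level e < m" for e
      using close[OF that] M[OF that(1)] that by (auto simp: h_def \<omega>\<^sub>1_def abs_less_iff)
    \<comment> \<open>Subtracting \<open>b\<close> on the levels below \<open>N\<close> makes the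
      summand nonpositive there, matching \<open>g k = 0\<close>.\<close>
    have "c k - \<delta> \<le> b" for k
      using c_bounds(2)[of k] \<open>0 < \<delta>\<close> by linarith
    then have "(\<Sum>k<m. c k - \<delta> - (if k < N then b else 0)) \<le> (\<Sum>k<m. g k)"
      by (intro sum_mono) (auto simp: g_def)
    also have "\<dots> \<le> ?T"
      unfolding m_def by (rule passage_time_bounds(1)[of g \<omega> _ h])
        (use g h in \<open>auto simp: g_def m_def\<close>)
    finally have lower: "(\<Sum>k<m. c k) - \<delta> * real m - real N * b \<le> ?T"
      using sum_if_less_le[of b N m] \<open>0 < b\<close> by (simp add: sum_subtractf mult.commute)
    have "?T \<le> (\<Sum>k<m. h k)"
      unfolding m_def by (rule passage_time_bounds(2)[of g \<omega> _ h])
        (use g h in \<open>auto simp: g_def m_def\<close>)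
    also have "\<dots> \<le> (\<Sum>k<m. c k + \<delta> + (if k < N then M else 0))"
      using c_bounds by (intro sum_mono) (auto simp: h_def)
    finally have upper: "?T \<le> (\<Sum>k<m. c k) + \<delta> * real m + real N * M"
      using sum_if_less_le[of M N m] \<open>0 \<le> M\<close> by (simp add: sum.distrib mult.commute)
    have "\<delta> * real m \<le> \<delta> * (s + CARD('d))"
      using m \<open>0 < \<delta>\<close> by (intro mult_left_mono) auto
    moreover have "\<bar>q * real m - q * s\<bar> \<le> q * CARD('d)"
      using m \<open>0 < q\<close> by (simp flip: right_diff_distrib add: abs_mult)
    moreover have "0 \<le> real N * b" "0 \<le> real N * M"
      using \<open>0 < b\<close> \<open>0 \<le> M\<close> by simp_all
    ultimately have "\<bar>?T - q * s\<bar> \<le> \<delta> * s + K"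
      using lower upper c(2)[of m] unfolding K_def distrib_left distrib_right abs_le_iff
      by linarith
    then have "\<bar>?T - q * s\<bar> < 2 * \<delta> * s"
      using K_less by linarith
    then have "\<bar>?T / s - q\<bar> < 2 * \<delta>"
      using \<open>0 < s\<close> by (simp add: field_simps abs_less_iff)
    moreover have "2 * \<delta> = 1 / real (Suc n)"
      by (simp add: \<delta>_def field_simps)
    ultimately show ?thesis
      unfolding near_value_configs_def mem_Collect_eq s_def
      by (intro exI[of _ \<mu>] conjI \<open>real n < \<mu>\<close>) (simp only:)
  qed
  ultimately show ?thesis by (intro exI[of _ V]) blast
qed

section \<open>From rational values to all values of the range\<close>

text \<open>If \<open>l < v\<close>, choose rationals squeezed between \<open>l\<close> and a
  sequence tending to \<open>l\<close> from above; otherwise \<open>l = v\<close> and the approach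
  is from below. Thus the endpoints, including an infinite one, are reached by rationals strictly
  inside the interval.\<close>

lemma exists_rat_seq_tendsto:
  fixes l u v :: ereal
  assumes "u \<le> l" "l \<le> v" "u < v"
  shows "\<exists>r :: nat \<Rightarrow> rat. (\<forall>n. u < ereal (of_rat (r n)) \<and> ereal (of_rat (r n)) < v) \<and>
           (\<lambda>n. ereal (of_rat (r n))) \<longlonglongrightarrow> l"
proof (cases "l < v")
  case True
  then obtain t where t: "\<And>n. l < t n" "t \<longlonglongrightarrow> l"
    using approx_from_above_dense_linorder[of l v] by blast
  have "\<exists>r. l < ereal (of_rat r) \<and> ereal (of_rat r) < min (t n) v" for n
    using ereal_dense3[of l "min (t n) v"] t(1)[of n] True by auto
  then obtain r where r: "\<And>n. l < ereal (of_rat (r n)) \<and> ereal (of_rat (r n)) < min (t n) v"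
    by metis
  have "(\<lambda>n. ereal (of_rat (r n))) \<longlonglongrightarrow> l"
    by (rule tendsto_sandwich[OF _ _ tendsto_const t(2)]) (use r in \<open>auto intro!: always_eventually less_imp_le\<close>)
  with r \<open>u \<le> l\<close> show ?thesis
    by (intro exI[of _ r]) (auto intro: le_less_trans)
next
  case False
  then have "u < l" using assms by auto
  then obtain t where t: "\<And>n. t n < l" "t \<longlonglongrightarrow> l"
    using approx_from_below_dense_linorder[of u l] by blast
  have "\<exists>r. max (t n) u < ereal (of_rat r) \<and> ereal (of_rat r) < l" for n
    using ereal_dense3[of "max (t n) u" l] t(1)[of n] \<open>u < l\<close> by auto
  then obtain r where r: "\<And>n. max (t n) u < ereal (of_rat (r n)) \<and> ereal (of_rat (r n)) < l"
    by metis
  have "(\<lambda>n. ereal (of_rat (r n))) \<longlonglongrightarrow> l"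
    by (rule tendsto_sandwich[OF _ _ t(2) tendsto_const]) (use r in \<open>auto intro!: always_eventually less_imp_le\<close>)
  with r \<open>l \<le> v\<close> show ?thesis
    by (intro exI[of _ r]) (auto intro: less_le_trans)
qed

theorem theorem1p4:
  fixes A :: "real set" and x :: "real ^ 'd"
  assumes "A \<subseteq> {0..}"
    and "\<exists>a\<in>A. \<exists>b\<in>A. a \<noteq> b"
    and "x \<noteq> 0"
  shows "\<exists>R :: ((int ^ 'd) set \<Rightarrow> real) set. residual_in (config_space A) R \<and>
    (\<forall>\<omega>\<in>R. \<forall>l :: ereal.
       (INF a\<in>A. ereal a) \<le> l \<and> l \<le> (SUP a\<in>A. ereal a) \<longrightarrow>
       (\<exists>\<mu> :: nat \<Rightarrow> real. (\<forall>k. \<mu> k > 0) \<and> filterlim \<mu> at_top sequentially \<and>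
          (\<lambda>k. ereal (passage_time \<omega> 0 (\<mu> k *\<^sub>R x) / (\<mu> k * l1_norm x)))
            \<longlonglongrightarrow> l))"
proof -
  let ?u = "INF a\<in>A. ereal a" and ?v = "SUP a\<in>A. ereal a"
  \<comment> \<open>Rational targets keep the intersection countable; the strict inequalities
    provide elements of \<open>A\<close> on both sides of each target.\<close>
  define Q :: "rat set" where "Q = {r. ?u < ereal (of_rat r) \<and> ereal (of_rat r) < ?v}"
  define S where "S = (\<lambda>(r :: rat, n). near_value_configs x (of_rat r) n)"
  define R where "R = topspace (config_space A) \<inter> (\<Inter>i\<in>Q \<times> UNIV. S i)"
  have "nowhere_dense_in (config_space A) (topspace (config_space A) - S i)"
    if i: "i \<in> Q \<times> UNIV" for i
  proof -
    obtain r n where rn: "i = (r, n)" "r \<in> Q" using i by auto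
    obtain a b where ab: "a \<in> A" "a < of_rat r" "b \<in> A" "of_rat r < b"
      using rn(2) by (auto simp: Q_def INF_less_iff less_SUP_iff)
    show ?thesis
      unfolding rn(1) S_def prod.case
      by (intro nowhere_dense_in_compl near_value_configs_dense[OF assms(1,3) ab(1,3,2,4)])
  qed
  then have "residual_in (config_space A) R"
    unfolding R_def by (intro residual_in_INT) auto
  moreover have "\<exists>\<mu> :: nat \<Rightarrow> real. (\<forall>k. \<mu> k > 0) \<and> filterlim \<mu> at_top sequentially \<and>
      (\<lambda>k. ereal (passage_time \<omega> 0 (\<mu> k *\<^sub>R x) / (\<mu> k * l1_norm x))) \<longlonglongrightarrow> l"
    if "\<omega> \<in> R" and l: "?u \<le> l" "l \<le> ?v" for \<omega> and l :: ereal
  proof -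
    define f where "f t = passage_time \<omega> 0 (t *\<^sub>R x) / (t * l1_norm x)" for t
    obtain a b where ab: "a \<in> A" "b \<in> A" "a < b"
      using assms(2) by (metis linorder_neqE)
    have "?u \<le> ereal a" "ereal b \<le> ?v"
      using ab by (auto intro: INF_lower SUP_upper)
    then have "?u < ?v"
      using \<open>a < b\<close> by (meson ereal_less(2) le_less_trans less_ereal.simps(1) less_le_trans)
    then obtain r :: "nat \<Rightarrow> rat"
      where r: "\<And>n. r n \<in> Q" "(\<lambda>n. ereal (of_rat (r n))) \<longlonglongrightarrow> l"
      using exists_rat_seq_tendsto[OF l] by (auto simp: Q_def)
    \<comment> \<open>Diagonal choice: the \<open>n\<close>-th rational is paired with the
      \<open>n\<close>-th tolerance, so the errors vanish while \<open>\<mu> n\<close> exceeds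
      \<open>n\<close>.\<close>
    have "\<omega> \<in> near_value_configs x (of_rat (r n)) n" for n
      using \<open>\<omega> \<in> R\<close> r(1)[of n] by (auto simp: R_def S_def)
    then have "\<exists>t > real n. \<bar>f t - of_rat (r n)\<bar> < 1 / real (Suc n)" for n
      by (auto simp: near_value_configs_def f_def)
    then obtain \<mu> where \<mu>: "\<And>n. real n < \<mu> n"
        "\<And>n. \<bar>f (\<mu> n) - of_rat (r n)\<bar> < 1 / real (Suc n)"
      by metis
    have "(\<lambda>n. f (\<mu> n) - of_rat (r n)) \<longlonglongrightarrow> 0"
      by (rule Lim_null_comparison[OF _ LIMSEQ_Suc[OF lim_1_over_n]])
        (use \<mu>(2) in \<open>auto intro!: always_eventually less_imp_le\<close>)
    \<comment> \<open>The limit \<open>l\<close> may be infinite, so the null sequence is added in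
      the extended reals, where a finite second limit keeps the sum well defined.\<close>
    then have "(\<lambda>n. ereal (f (\<mu> n) - of_rat (r n))) \<longlonglongrightarrow> 0"
      by (simp add: zero_ereal_def)
    then have "(\<lambda>n. ereal (of_rat (r n)) + ereal (f (\<mu> n) - of_rat (r n))) \<longlonglongrightarrow> l + 0"
      using r(2) by (intro tendsto_add_ereal_general) auto
    then have "(\<lambda>n. ereal (f (\<mu> n))) \<longlonglongrightarrow> l" by simp
    moreover have "filterlim \<mu> at_top sequentially"
      by (rule filterlim_at_top_mono[OF filterlim_real_sequentially])
        (use \<mu>(1) in \<open>auto intro!: always_eventually less_imp_le\<close>)
    moreover have "0 < \<mu> k" for k
      using \<mu>(1)[of k] by linarith
    ultimately show ?thesis
      unfolding f_def by blast
  qed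
  ultimately show ?thesis by blast
qed

end
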